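(* Let $k$ be a number field with algebraic closure $\overline{k}$, let $S\subseteq M_k$ be a finite set of places of $k$ including all the archimedean places, let $d\geq 2$ be an integer, and for $c\in\overline{k}$ let $f_{d,c}(z):=z^d+c$. Let $r\geq 1$ and let $\alpha_1,\ldots,\alpha_r\in k$ be parameters such that each $f_{d,\alpha_i}$ is postcritically finite. Then there are infinitely many parameters $c\in\overline{k}$ that are $S$-integral relative to the divisor $D:=(\alpha_1)+\cdots+(\alpha_r)$ and for which $f_{d,c}$ is postcritically finite.
   Context: $M_k$ is the set of places of $k$; $\mathbb{C}_v$ is the completion of an algebraic closure of $k_v$ with absolute value $|\cdot|_v$. $f_{d,c}$ is postcritically finite iff the orbit $\{f_{d,c}^n(0):n\ge0\}$ is finite. A point $x\in\overline{k}$ is $S$-integral relative to $D$ if for every $v\in M_k\setminus S$, every $i$, and all $k$-embeddings $\sigma,\tau:\overline{k}\hookrightarrow\mathbb{C}_v$, the points $\sigma(x)$ and $\tau(\alpha_i)$ lie in different residue classes of $\mathbb{P}^1(\mathbb{C}_v)$; concretely, $|\sigma(x)-\tau(\alpha_i)|_v\ge1$ if $|\tau(\alpha_i)|_v\le1$, and $|\sigma(x)|_v\le1$ if $|\tau(\alpha_i)|_v>1$. *)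

theory Defs
  imports
    "HOL-Analysis.Abstract_Metric_Spaces"
    "HOL-Algebra.Algebraic_Closure_Type"
begin

definition number_field :: "'k::field_char_0 itself \<Rightarrow> bool" where
  "number_field _ \<longleftrightarrow>
     (\<exists>B. finite_dimensional_vector_space (\<lambda>(q::rat) (x::'k). of_rat q * x) B)"

locale valued_field = field R for R (structure) +
  fixes N :: "'a \<Rightarrow> real"
  assumes N_nonneg: "x \<in> carrier R \<Longrightarrow> 0 \<le> N x"
    and N_eq_0_iff: "x \<in> carrier R \<Longrightarrow> N x = 0 \<longleftrightarrow> x = \<zero>"
    and N_mult: "\<lbrakk>x \<in> carrier R; y \<in> carrier R\<rbrakk> \<Longrightarrow> N (x \<otimes> y) = N x * N y"
    and N_triangle: "\<lbrakk>x \<in> carrier R; y \<in> carrier R\<rbrakk> \<Longrightarrow> N (x \<oplus> y) \<le> N x + N y"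

text \<open>The value off the carrier is irrelevant; it is set to 0 because the library's
  metric spaces ask for non-negativity and symmetry on the whole type.\<close>

definition val_dist :: "('a, 'b) ring_scheme \<Rightarrow> ('a \<Rightarrow> real) \<Rightarrow> 'a \<Rightarrow> 'a \<Rightarrow> real" where
  "val_dist R N x y =
     (if x \<in> carrier R \<and> y \<in> carrier R then N (x \<ominus>\<^bsub>R\<^esub> y) else 0)"

lemma (in valued_field) Metric_space_val_dist: "Metric_space (carrier R) (val_dist R N)"
proof
  have one: "N \<one> = 1"
    using N_mult[of \<one> \<one>] N_eq_0_iff[of \<one>] by simp
  have "N (\<ominus> \<one>) * N (\<ominus> \<one>) = 1"
    using N_mult[of "\<ominus> \<one>" "\<ominus> \<one>"] one by (simp add: l_minus r_minus)
  then have m1: "N (\<ominus> \<one>) = 1"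
    using N_nonneg[of "\<ominus> \<one>"] by (auto simp: square_eq_1_iff)
  have minus: "N (\<ominus> x) = N x" if "x \<in> carrier R" for x
    using N_mult[of "\<ominus> \<one>" x] that m1 by (simp add: l_minus)
  show "0 \<le> val_dist R N x y" for x y
    by (simp add: val_dist_def N_nonneg)
  show "val_dist R N x y = val_dist R N y x" for x y
  proof (cases "x \<in> carrier R \<and> y \<in> carrier R")
    case True
    then have "\<ominus> (x \<ominus> y) = y \<ominus> x"
      by (simp add: a_minus_def minus_add a_comm)
    with True minus[of "x \<ominus> y"] show ?thesis
      by (simp add: val_dist_def)
  qed (auto simp: val_dist_def)
  show "val_dist R N x y = 0 \<longleftrightarrow> x = y" if "x \<in> carrier R" "y \<in> carrier R" for x y
    using that by (simp add: val_dist_def N_eq_0_iff)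
  show "val_dist R N x z \<le> val_dist R N x y + val_dist R N y z"
    if "x \<in> carrier R" "y \<in> carrier R" "z \<in> carrier R" for x y z
  proof -
    have "x \<ominus> z = (x \<ominus> y) \<oplus> (y \<ominus> z)"
      using that by (simp add: a_minus_def a_assoc r_neg1)
    with that N_triangle[of "x \<ominus> y" "y \<ominus> z"] show ?thesis
      by (simp add: val_dist_def)
  qed
qed

definition absolute_values :: "('k::field \<Rightarrow> real) set" where
  "absolute_values =
     {v. valued_field ring_of_type_algebra v \<and> (\<exists>x. x \<noteq> 0 \<and> v x \<noteq> 1)}"

definition absolute_value_equiv :: "(('k::field \<Rightarrow> real) \<times> ('k \<Rightarrow> real)) set" where
  "absolute_value_equiv =
     {(v, w). v \<in> absolute_values \<and> w \<in> absolute_values \<and>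
        (\<exists>s>0. \<forall>x. w x = v x powr s)}"

definition places :: "('k::field \<Rightarrow> real) set set" where
  "places = absolute_values // absolute_value_equiv"

lemma equiv_absolute_value_equiv: "equiv absolute_values absolute_value_equiv"
proof (rule equivI)
  have nn: "0 \<le> v x" if "v \<in> absolute_values" for v :: "'a \<Rightarrow> real" and x
    using that valued_field.N_nonneg[of ring_of_type_algebra v x]
    by (auto simp: absolute_values_def ring_of_type_algebra_def)
  show "absolute_value_equiv \<subseteq> absolute_values \<times> (absolute_values :: ('a \<Rightarrow> real) set)"
    by (auto simp: absolute_value_equiv_def)
  show "refl_on absolute_values (absolute_value_equiv :: (('a \<Rightarrow> real) \<times> _) set)"
    by (auto simp: refl_on_def absolute_value_equiv_def nn intro!: exI[of _ 1])
  show "sym (absolute_value_equiv :: (('a \<Rightarrow> real) \<times> _) set)"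
  proof (rule symI)
    fix v w :: "'a \<Rightarrow> real"
    assume "(v, w) \<in> absolute_value_equiv"
    then obtain s where s: "v \<in> absolute_values" "w \<in> absolute_values" "s > 0"
      "\<And>x. w x = v x powr s"
      by (auto simp: absolute_value_equiv_def)
    then have "\<forall>x. v x = w x powr inverse s"
      by (simp add: powr_powr nn)
    with s show "(w, v) \<in> absolute_value_equiv"
      by (auto simp: absolute_value_equiv_def intro!: exI[of _ "inverse s"])
  qed
  show "trans (absolute_value_equiv :: (('a \<Rightarrow> real) \<times> _) set)"
  proof (rule transI)
    fix u v w :: "'a \<Rightarrow> real"
    assume "(u, v) \<in> absolute_value_equiv" "(v, w) \<in> absolute_value_equiv"
    then obtain s t where "u \<in> absolute_values" "w \<in> absolute_values" "s > 0" "t > 0"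
      "\<And>x. v x = u x powr s" "\<And>x. w x = v x powr t"
      by (auto simp: absolute_value_equiv_def)
    then show "(u, w) \<in> absolute_value_equiv"
      by (auto simp: absolute_value_equiv_def powr_powr intro!: exI[of _ "s * t"])
  qed
qed

text \<open>Equivalent absolute values satisfy the ultrametric inequality simultaneously.\<close>

definition archimedean_place :: "('k::field \<Rightarrow> real) set \<Rightarrow> bool" where
  "archimedean_place V \<longleftrightarrow> (\<exists>v\<in>V. \<exists>x y. v (x + y) > max (v x) (v y))"

definition completion_in ::
    "('a, 'b) ring_scheme \<Rightarrow> ('a \<Rightarrow> real) \<Rightarrow> 'a set \<Rightarrow> 'a set \<Rightarrow> bool" where
  "completion_in C N F L \<longleftrightarrow>
     F \<subseteq> L \<and> subfield L C \<and>
     Metric_space.mcomplete L (val_dist C N) \<and>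
     Metric_space.mtopology L (val_dist C N) closure_of F = L"

text \<open>\<open>C\<close> with absolute value \<open>N\<close> and structure map \<open>\<iota>\<close> is the completion of an algebraic
  closure \<open>A\<close> of the completion \<open>K\<close> of the type \<open>'k\<close> at \<open>v\<close>.  This determines
  \<open>(C, N, \<iota>)\<close> up to isometric isomorphism.\<close>

definition is_C_v ::
    "('k::field \<Rightarrow> real) \<Rightarrow> 'c ring \<Rightarrow> ('c \<Rightarrow> real) \<Rightarrow> ('k \<Rightarrow> 'c) \<Rightarrow> bool" where
  "is_C_v v C N \<iota> \<longleftrightarrow>
     valued_field C N \<and>
     \<iota> \<in> ring_hom ring_of_type_algebra C \<and> (\<forall>x. N (\<iota> x) = v x) \<and>
     (\<exists>K A. completion_in C N (range \<iota>) K \<and>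
            subfield A C \<and> algebraic_closure (C\<lparr>carrier := A\<rparr>) K \<and>
            completion_in C N A (carrier C))"

definition k_embeddings :: "('k::field \<Rightarrow> 'c) \<Rightarrow> 'c ring \<Rightarrow> ('k alg_closure \<Rightarrow> 'c) set" where
  "k_embeddings \<iota> C =
     {\<sigma> \<in> ring_hom ring_of_type_algebra C. \<forall>x. \<sigma> (to_ac x) = \<iota> x}"

definition diff_residue_classes ::
    "('c, 'b) ring_scheme \<Rightarrow> ('c \<Rightarrow> real) \<Rightarrow> 'c \<Rightarrow> 'c \<Rightarrow> bool" where
  "diff_residue_classes C N x a \<longleftrightarrow>
     (N a \<le> 1 \<longrightarrow> N (x \<ominus>\<^bsub>C\<^esub> a) \<ge> 1) \<and> (N a > 1 \<longrightarrow> N x \<le> 1)"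

text \<open>An effective divisor is the multiset of its points.  The fields \<open>\<complex>\<^sub>v\<close> vary with the
  place, so they cannot each be a type; since \<open>\<complex>\<^sub>v\<close> (for \<open>k\<close> a number field) has the
  cardinality of the continuum, it is enough to let the carrier be a set of elements of the
  type \<open>real\<close>, used as a bare set.  As \<open>\<complex>\<^sub>v\<close> is unique up to isometric isomorphism over \<open>k\<close>,
  the quantification over all its models and over all representatives \<open>v\<close> of the place says
  the same as any fixed choice.\<close>

definition S_integral ::
    "('k::field \<Rightarrow> real) set set \<Rightarrow> 'k alg_closure multiset \<Rightarrow> 'k alg_closure \<Rightarrow> bool" where
  "S_integral S D x \<longleftrightarrow>
     (\<forall>V \<in> places - S. \<forall>v \<in> V. \<forall>(C :: real ring) N \<iota>. is_C_v v C N \<iota> \<longrightarrow>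
        (\<forall>a \<in># D. \<forall>\<sigma> \<in> k_embeddings \<iota> C. \<forall>\<tau> \<in> k_embeddings \<iota> C.
           diff_residue_classes C N (\<sigma> x) (\<tau> a)))"

definition unicrit :: "nat \<Rightarrow> 'a::field \<Rightarrow> 'a \<Rightarrow> 'a" where
  "unicrit d c z = z ^ d + c"

definition postcritically_finite :: "nat \<Rightarrow> 'a::field \<Rightarrow> bool" where
  "postcritically_finite d c \<longleftrightarrow> finite {(unicrit d c ^^ n) 0 | n. True}"

end

theory Submission
  imports Defs
begin

text \<open>
  Take a prime \<open>p\<close> exceeding the sizes of the critical orbits of all \<open>\<alpha>\<^sub>i\<close>, and a parameter
  \<open>c \<noteq> 0\<close> for which \<open>0\<close> has period \<open>p\<close>.  Suppose that \<open>c\<close> and \<open>a = \<alpha>\<^sub>i\<close> are congruent modulo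
  a non-archimedean place.  If \<open>\<bar>a\<bar> < 1\<close>, then \<open>\<bar>c\<bar> < 1\<close>, every \<open>f\<^sub>c\<^sup>n(0)\<close> with \<open>n \<ge> 1\<close> has
  absolute value \<open>\<bar>c\<bar>\<close>, and \<open>c = 0\<close>.  If \<open>\<bar>a\<bar> = 1\<close>, then the reduction of \<open>0\<close> under \<open>f\<^sub>a\<close> is
  periodic with period dividing \<open>p\<close> and not \<open>1\<close>, so its orbit has \<open>p\<close> elements, which are
  more than there are in the orbit of \<open>0\<close> under \<open>f\<^sub>a\<close>.  Different primes \<open>p\<close> give different
  parameters \<open>c\<close>.
\<close>

section \<open>Return times modulo a symmetric and transitive relation\<close>

text \<open>Reflexivity is not assumed, so that the lemma applies to a residue relation confined to
  the unit ball.\<close>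

lemma funpow_related_multiple:
  assumes "symp R" "transp R" and "\<And>x y. R x y \<Longrightarrow> R (f x) (f y)"
    and "R ((f ^^ m) x) x"
  shows "R ((f ^^ (k * m)) x) x"
proof -
  have step: "R ((f ^^ m) y) ((f ^^ m) z)" if "R y z" for y z
    using that by (induction m) (auto intro: assms(3))
  show ?thesis
  proof (induction k)
    case 0
    \<comment> \<open>Here \<open>R x x\<close> is required; it follows from
      \<open>R ((f ^^ m) x) x\<close> by symmetry and transitivity.\<close>
    show ?case using assms(1,2,4) by (metis funpow_0 mult_0 sympD transpD)
  next
    case (Suc k)
    have "(f ^^ (Suc k * m)) x = (f ^^ m) ((f ^^ (k * m)) x)"
      by (simp add: funpow_add)
    with step[OF Suc] assms(2,4) show ?case by (metis transpD)
  qed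
qed

text \<open>By Bezout some multiple of \<open>m\<close> exceeds a multiple of \<open>n\<close> by
  exactly 1. The iterate at that time is related both to \<open>x\<close> and to
  \<open>f x\<close>.\<close>

lemma funpow_related_coprime:
  fixes m n :: nat
  assumes R: "symp R" "transp R" "\<And>x y. R x y \<Longrightarrow> R (f x) (f y)"
    and m: "R ((f ^^ m) x) x" and n: "R ((f ^^ n) x) x"
    and "coprime m n" "m \<noteq> 0"
  shows "R (f x) x"
proof -
  obtain i j where ij: "i * m = j * n + 1"
    using bezout_nat[OF \<open>m \<noteq> 0\<close>, of n] \<open>coprime m n\<close> by (auto simp: mult.commute)
  have "R ((f ^^ (i * m)) x) x" "R ((f ^^ (j * n)) x) x"
    using m n by (auto intro!: funpow_related_multiple[of R f, OF R])
  moreover from this(2) have "R ((f ^^ (i * m)) x) (f x)"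
    unfolding ij by (auto intro: R(3))
  ultimately show ?thesis
    using R(1,2) by (metis sympD transpD)
qed

section \<open>The critical orbit under an ultrametric absolute value\<close>

lemma unicrit_zero: "d \<ge> 2 \<Longrightarrow> unicrit d c 0 = c"
  by (simp add: unicrit_def power_0_left)

text \<open>To be instantiated with \<open>\<lambda>x. N (\<sigma> x)\<close>, the pullback of the
  absolute value along an embedding, so that computations take place in a field type.\<close>

locale ultrametric_value =
  fixes w :: "'a::field \<Rightarrow> real"
  assumes nonneg: "0 \<le> w x"
    and eq_0_iff: "w x = 0 \<longleftrightarrow> x = 0"
    and mult: "w (x * y) = w x * w y"
    and ultra: "w (x + y) \<le> max (w x) (w y)"
begin

lemma one [simp]: "w 1 = 1"
  using mult[of 1 1] eq_0_iff[of 1] by simp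

lemma zero [simp]: "w 0 = 0"
  by (simp add: eq_0_iff)

lemma power: "w (x ^ n) = w x ^ n"
  by (induction n) (auto simp: mult)

lemma minus [simp]: "w (- x) = w x"
proof -
  have "w (- 1) ^ 2 = 1"
    using mult[of "- 1" "- 1"] by (simp add: power2_eq_square)
  then have "w (- 1) = 1"
    using nonneg[of "- 1"] by (simp add: power2_eq_1_iff)
  then show ?thesis using mult[of "- 1" x] by simp
qed

lemma diff_commute: "w (x - y) = w (y - x)"
  using minus[of "x - y"] by simp

lemma diff_le: "w (x - y) \<le> max (w x) (w y)"
  using ultra[of x "- y"] by simp

text \<open>The lower bound comes from \<open>x = (x + y) - y\<close>, where the strict hypothesis
  keeps \<open>w y\<close> from being the maximum.\<close>

lemma add_eq:
  assumes "w y < w x"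
  shows "w (x + y) = w x"
  using ultra[of x y] diff_le[of "x + y" y] assms by auto

lemma power_diff_less:
  assumes "w x \<le> 1" "w y \<le> 1" "w (x - y) < 1"
  shows "w (x ^ n - y ^ n) < 1"
proof (induction n)
  case (Suc n)
  have "x ^ Suc n - y ^ Suc n = x * (x ^ n - y ^ n) + (x - y) * y ^ n"
    by (simp add: algebra_simps)
  moreover have "w (x * (x ^ n - y ^ n)) < 1"
    using Suc assms(1) nonneg[of x] nonneg[of "x ^ n - y ^ n"]
    by (simp add: mult) (meson le_less_trans mult_left_le_one_le)
  moreover have "w ((x - y) * y ^ n) < 1"
    using assms(2,3) nonneg[of y] nonneg[of "x - y"]
    by (simp add: mult power)
       (meson le_less_trans mult_right_le_one_le power_le_one zero_le_power)
  ultimately show ?case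
    using ultra[of "x * (x ^ n - y ^ n)" "(x - y) * y ^ n"] by simp
qed simp

text \<open>Confining the relation to the unit ball is what makes it invariant under \<open>unicrit\<close>;
  it is thus only a partial equivalence.\<close>

definition same_residue :: "'a \<Rightarrow> 'a \<Rightarrow> bool" where
  "same_residue x y \<longleftrightarrow> w x \<le> 1 \<and> w y \<le> 1 \<and> w (x - y) < 1"

lemma symp_same_residue: "symp same_residue"
  by (auto simp: symp_def same_residue_def diff_commute)

lemma transp_same_residue: "transp same_residue"
proof (rule transpI)
  fix x y z assume "same_residue x y" "same_residue y z"
  then show "same_residue x z"
    using ultra[of "x - y" "y - z"] by (auto simp: same_residue_def)
qed

lemma unicrit_same_residue:
  assumes "same_residue x y" "same_residue a b"
  shows "same_residue (unicrit d a x) (unicrit d b y)"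
proof -
  have "w (unicrit d a x) \<le> 1" "w (unicrit d b y) \<le> 1"
    using assms ultra[of "x ^ d" a] ultra[of "y ^ d" b] nonneg[of x] nonneg[of y]
      power_le_one[of "w x" d] power_le_one[of "w y" d]
    by (auto simp: same_residue_def unicrit_def power)
  moreover have "unicrit d a x - unicrit d b y = (x ^ d - y ^ d) + (a - b)"
    by (simp add: unicrit_def)
  moreover have "w (x ^ d - y ^ d) < 1" "w (a - b) < 1"
    using assms power_diff_less by (auto simp: same_residue_def)
  ultimately show ?thesis
    using ultra[of "x ^ d - y ^ d" "a - b"] by (simp add: same_residue_def)
qed

lemma unicrit_orbit_same_residue:
  assumes "same_residue a b"
  shows "same_residue ((unicrit d a ^^ n) 0) ((unicrit d b ^^ n) 0)"
proof (induction n)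
  case 0
  show ?case by (simp add: same_residue_def)
next
  case (Suc n)
  with assms show ?case by (simp add: unicrit_same_residue)
qed

text \<open>Once \<open>w z \<ge> w c > 1\<close>, the term \<open>z ^ d\<close> strictly dominates
  \<open>c\<close>, and so the orbit never comes back to 0.\<close>

lemma unicrit_orbit_escapes:
  assumes "d \<ge> 2" "w c > 1"
  shows "w c \<le> w ((unicrit d c ^^ Suc n) 0)"
proof (induction n)
  case 0
  show ?case using \<open>d \<ge> 2\<close> by (simp add: unicrit_zero)
next
  case (Suc n)
  let ?z = "(unicrit d c ^^ Suc n) 0"
  have "w c < w c ^ 2"
    using assms(2) by (simp add: power2_eq_square)
  also have "\<dots> \<le> w ?z ^ 2"
    using Suc nonneg by (intro power_mono)
  also have "\<dots> \<le> w ?z ^ d"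
    using Suc assms by (intro power_increasing) auto
  finally have "w (?z ^ d + c) = w (?z ^ d)" "w c < w (?z ^ d)"
    using add_eq[of c "?z ^ d"] by (auto simp: power)
  moreover have "(unicrit d c ^^ Suc (Suc n)) 0 = ?z ^ d + c" by (simp add: unicrit_def)
  ultimately show ?case by (simp only:)
qed

text \<open>Now \<open>c\<close> dominates instead: for \<open>0 < w c < 1\<close>, the value
  \<open>w c ^ d\<close> of \<open>z ^ d\<close> is below \<open>w c\<close>. The strict inequality
  fails at \<open>c = 0\<close>, which is treated apart.\<close>

lemma unicrit_orbit_value:
  assumes "d \<ge> 2" "w c < 1"
  shows "w ((unicrit d c ^^ Suc n) 0) = w c"
proof (induction n)
  case 0
  show ?case using \<open>d \<ge> 2\<close> by (simp add: unicrit_zero)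
next
  case (Suc n)
  let ?z = "(unicrit d c ^^ Suc n) 0"
  show ?case
  proof (cases "c = 0")
    case True
    with Suc \<open>d \<ge> 2\<close> show ?thesis by (simp add: eq_0_iff unicrit_def power_0_left)
  next
    case False
    then have "0 < w c" using nonneg[of c] eq_0_iff[of c] by simp
    have "w (?z ^ d) = w c ^ d" by (simp only: power Suc)
    also have "\<dots> \<le> w c ^ 2"
      using assms \<open>0 < w c\<close> by (intro power_decreasing) auto
    also have "\<dots> < w c"
      using assms(2) \<open>0 < w c\<close> by (simp add: power2_eq_square)
    finally have "w (c + ?z ^ d) = w c" by (rule add_eq)
    moreover have "(unicrit d c ^^ Suc (Suc n)) 0 = c + ?z ^ d" by (simp add: unicrit_def)
    ultimately show ?thesis by (simp only:)
  qed
qed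

lemma periodic_parameter_value:
  assumes "d \<ge> 2" "n > 0" "(unicrit d c ^^ n) 0 = 0"
  shows "w c \<le> 1"
proof (rule ccontr)
  assume "\<not> w c \<le> 1"
  then show False
    using unicrit_orbit_escapes[of d c "n - 1"] assms by simp
qed

lemma periodic_parameter_separated:
  fixes p :: nat
  assumes d: "d \<ge> 2" and p: "prime p" and c: "c \<noteq> 0" "(unicrit d c ^^ p) 0 = 0"
    and a: "w a \<le> 1"
    and fin: "finite {(unicrit d a ^^ n) 0 | n. True}"
    and card: "card {(unicrit d a ^^ n) 0 | n. True} < p"
  shows "1 \<le> w (c - a)"
proof (rule ccontr)
  let ?g = "\<lambda>n. (unicrit d a ^^ n) 0"
  assume "\<not> 1 \<le> w (c - a)"
  moreover have "p > 0" using p by (rule prime_gt_0_nat)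
  ultimately have ca: "same_residue c a"
    using a periodic_parameter_value[OF d _ c(2)] by (simp add: same_residue_def)
  have aa: "same_residue a a" using a by (simp add: same_residue_def)
  \<comment> \<open>Otherwise the \<open>p\<close>-th iterate, which is 0, would have the nonzero
    value \<open>w c\<close>.\<close>
  have "\<not> w c < 1"
    using unicrit_orbit_value[OF d, of c "p - 1"] c \<open>p > 0\<close> by (auto simp: eq_0_iff)
  then have a1: "\<not> w a < 1"
    using ca add_eq[of "c - a" a] ultra[of "c - a" a] by (auto simp: same_residue_def)
  \<comment> \<open>Pigeonhole: the orbit of 0 under \<open>unicrit d a\<close> has fewer than
    \<open>p\<close> points.\<close>
  have "\<not> inj_on ?g {..<p}"
  proof
    assume "inj_on ?g {..<p}"
    then have "p = card (?g ` {..<p})" by (simp add: card_image)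
    also have "\<dots> \<le> card {?g n | n. True}" using fin by (intro card_mono) auto
    finally show False using card by simp
  qed
  then obtain i j where ij: "i < j" "j < p" "?g i = ?g j"
    by (auto simp: inj_on_def) (metis linorder_neqE_nat)
  define e where "e = j - i"
  have e: "0 < e" "e < p" using ij by (auto simp: e_def)
  \<comment> \<open>As \<open>p > i\<close>, the point \<open>?g p\<close> already lies on the
    cycle, so advancing it by \<open>e\<close> steps fixes it exactly.\<close>
  have "?g p = (unicrit d a ^^ (p - i)) (?g i)"
    using ij by (metis (no_types) add.commute comp_apply funpow_add le_add_diff_inverse2 less_trans less_imp_le)
  also have "\<dots> = ?g (p - i + j)" by (simp add: ij funpow_add)
  also have "p - i + j = e + p" using ij by (simp add: e_def)
  finally have gp: "?g p = (unicrit d a ^^ e) (?g p)"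
    unfolding funpow_add comp_apply .
  have p0: "same_residue (?g p) 0"
    using unicrit_orbit_same_residue[OF ca, of p d] c(2) symp_same_residue
    by (auto dest: sympD)
  have "same_residue ((unicrit d a ^^ n) x) ((unicrit d a ^^ n) y)"
    if "same_residue x y" for x y n
    using that by (induction n) (auto intro: unicrit_same_residue aa)
  \<comment> \<open>Applying \<open>e\<close> iterations to \<open>?g p\<close> and 0, which are
    congruent, shows that \<open>e\<close> is a second return time of 0 modulo the place. It is
    coprime to \<open>p\<close>, which forces \<open>w a < 1\<close>.\<close>
  from this[OF p0, of e] have "same_residue (?g p) (?g e)"
    unfolding gp[symmetric] .
  then have e0: "same_residue (?g e) 0"
    using p0 symp_same_residue transp_same_residue by (metis sympD transpD)
  have "coprime e p"
    using p e by (metis coprime_commute nat_dvd_not_less prime_imp_coprime)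
  then have "same_residue (unicrit d a 0) 0"
    using funpow_related_coprime[OF symp_same_residue transp_same_residue _ e0 p0] e aa
    by (auto intro: unicrit_same_residue)
  then show False
    using a1 d by (simp add: same_residue_def unicrit_zero)
qed

end

section \<open>The ultrametric inequality from boundedness on the integers\<close>

text \<open>The binomial theorem bounds \<open>w (x + y) ^ n\<close> by
  \<open>(n + 1) * M ^ n\<close> with \<open>M\<close> the maximum of \<open>w x\<close> and
  \<open>w y\<close>; as \<open>n\<close> grows, the factor \<open>n + 1\<close> cannot make up for
  a ratio \<open>M / w (x + y)\<close> below 1.\<close>

lemma ultrametric_valueI:
  fixes w :: "'a::field \<Rightarrow> real"
  assumes nonneg: "\<And>x. 0 \<le> w x"
    and eq_0_iff: "\<And>x. w x = 0 \<longleftrightarrow> x = 0"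
    and mult: "\<And>x y. w (x * y) = w x * w y"
    and triangle: "\<And>x y. w (x + y) \<le> w x + w y"
    and nat: "\<And>n. w (of_nat n) \<le> 1"
  shows "ultrametric_value w"
proof
  fix x y
  show "w (x + y) \<le> max (w x) (w y)"
  proof (rule ccontr)
    define M where "M = max (w x) (w y)"
    assume "\<not> ?thesis"
    then have less: "M < w (x + y)" by (simp add: M_def not_le)
    have one: "w 1 = 1" using mult[of 1 1] eq_0_iff[of 1] by simp
    have pow: "w (z ^ n) = w z ^ n" for z n
      by (induction n) (auto simp: one mult)
    have sum: "w (sum f A) \<le> (\<Sum>i\<in>A. w (f i))" if "finite A" for f and A :: "nat set"
      using that
    proof induction
      case empty
      show ?case using eq_0_iff[of 0] by simp
    next
      case (insert i A)
      then show ?case using triangle[of "f i" "sum f A"] by simp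
    qed
    have "0 \<le> M" using nonneg[of x] by (simp add: M_def)
    have bound: "w (x + y) ^ n \<le> real (n + 1) * M ^ n" for n
    proof -
      have "w (x + y) ^ n = w (\<Sum>k\<le>n. of_nat (n choose k) * x ^ k * y ^ (n - k))"
        by (simp add: pow[symmetric] binomial_ring)
      also have "\<dots> \<le> (\<Sum>k\<le>n. w (of_nat (n choose k) * x ^ k * y ^ (n - k)))"
        by (rule sum) simp
      also have "\<dots> \<le> (\<Sum>k\<le>n. M ^ n)"
      proof (rule sum_mono)
        fix k assume "k \<in> {..n}"
        have "w (of_nat (n choose k) * x ^ k * y ^ (n - k))
            = w (of_nat (n choose k)) * (w x ^ k * w y ^ (n - k))"
          by (simp add: mult pow)
        also have "\<dots> \<le> 1 * (M ^ k * M ^ (n - k))"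
          using nonneg \<open>0 \<le> M\<close> nat
          by (intro mult_mono power_mono) (auto simp: M_def)
        also have "\<dots> = M ^ n" using \<open>k \<in> {..n}\<close> by (simp flip: power_add)
        finally show "w (of_nat (n choose k) * x ^ k * y ^ (n - k)) \<le> M ^ n" .
      qed
      finally show ?thesis by simp
    qed
    define r where "r = M / w (x + y)"
    have r: "0 \<le> r" "r < 1" using less \<open>0 \<le> M\<close> by (auto simp: r_def)
    have "1 \<le> real (n + 1) * r ^ n" for n
      using bound[of n] less \<open>0 \<le> M\<close> by (simp add: r_def power_divide field_simps)
    moreover have "(\<lambda>n. real (n + 1) * r ^ n) \<longlonglongrightarrow> 0"
    proof -
      have "(\<lambda>n. real n * r ^ n + r ^ n) \<longlonglongrightarrow> 0 + 0"
        using r by (intro tendsto_add powser_times_n_limit_0 LIMSEQ_realpow_zero) auto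
      then show ?thesis by (simp add: algebra_simps)
    qed
    ultimately have "1 \<le> (0::real)"
      by (intro LIMSEQ_le_const) auto
    then show False by simp
  qed
qed (use assms in auto)

section \<open>Existence and distinctness of periodic parameters\<close>

text \<open>Splitting off the trivial root \<open>c = 0\<close> leaves a cofactor with constant term
  1, all of whose roots are therefore nonzero.\<close>

lemma unicrit_orbit_polynomial:
  fixes d n :: nat
  assumes "d \<ge> 2"
  shows "\<exists>h :: 'a::field poly. (\<forall>c. (unicrit d c ^^ Suc n) 0 = c * poly h c) \<and>
           poly h 0 = 1 \<and> (n > 0 \<longrightarrow> degree h > 0)"
proof (induction n)
  case 0
  show ?case using assms by (intro exI[of _ 1]) (auto simp: unicrit_def)
next
  case (Suc n)
  then obtain h :: "'a poly" where
    h: "\<And>c. (unicrit d c ^^ Suc n) 0 = c * poly h c" "poly h 0 = 1" by blast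
  \<comment> \<open>From \<open>(c * h) ^ d + c = c * (c ^ (d - 1) * h ^ d + 1)\<close>, the next
    cofactor is \<open>?m + 1\<close>.\<close>
  let ?m = "monom 1 (d - 1) * h ^ d"
  have "h \<noteq> 0" using h(2) by auto
  then have "degree ?m = d - 1 + d * degree h"
    by (simp add: degree_mult_eq degree_monom_eq degree_power_eq)
  then have deg: "degree (?m + 1) > 0"
    using assms by (subst degree_add_eq_left) auto
  have "(unicrit d c ^^ Suc (Suc n)) 0 = c * poly (?m + 1) c" for c
  proof -
    have "c ^ d = c * c ^ (d - 1)"
      using assms by (cases d) auto
    then show ?thesis
      using h(1)[of c] by (simp add: unicrit_def poly_monom algebra_simps)
  qed
  then show ?case
    using assms deg by (intro exI[of _ "?m + 1"]) (auto simp: poly_monom)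
qed

lemma exists_periodic_parameter:
  assumes "d \<ge> 2" "n \<ge> 2"
  obtains c :: "'a::alg_closed_field" where "c \<noteq> 0" "(unicrit d c ^^ n) 0 = 0"
proof -
  obtain h :: "'a poly" where h: "\<And>c. (unicrit d c ^^ n) 0 = c * poly h c"
    "poly h 0 = 1" "degree h > 0"
    using unicrit_orbit_polynomial[OF assms(1), of "n - 1"] assms(2) by auto
  obtain c where "poly h c = 0"
    using alg_closed_imp_poly_has_root[OF h(3)] by auto
  with h that[of c] show thesis by (metis mult_zero_right zero_neq_one)
qed

text \<open>Two coprime return times would make 0 a fixed point, but 0 is sent to \<open>c\<close>.
  Hence a nonzero parameter cannot serve two distinct primes.\<close>

lemma periodic_parameter_inj:
  fixes c :: "'a::field"
  assumes "d \<ge> 2" "coprime p q" "p \<noteq> 0"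
    and "(unicrit d c ^^ p) 0 = 0" "(unicrit d c ^^ q) 0 = 0"
  shows "c = 0"
proof -
  have "unicrit d c 0 = 0"
    by (rule funpow_related_coprime[where R = "(=)" and m = p and n = q])
       (use assms in \<open>auto simp: symp_def transp_def\<close>)
  with assms(1) show ?thesis by (simp add: unicrit_zero)
qed

lemma periodic_imp_postcritically_finite:
  assumes "n > 0" "(unicrit d c ^^ n) 0 = 0"
  shows "postcritically_finite d c"
proof -
  have "(unicrit d c ^^ m) 0 \<in> (\<lambda>i. (unicrit d c ^^ i) 0) ` {..<n}" for m
    using assms funpow_mod_eq[of n "unicrit d c" 0 m] by (auto intro!: image_eqI[of _ _ "m mod n"])
  then have "{(unicrit d c ^^ m) 0 | m. True} \<subseteq> (\<lambda>i. (unicrit d c ^^ i) 0) ` {..<n}"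
    by auto
  then show ?thesis
    unfolding postcritically_finite_def by (rule finite_subset) simp
qed

section \<open>Embeddings into completions and integrality\<close>

text \<open>The place gives the ultrametric inequality only on the base field. This bounds the
  integers by 1, and since they lie in the base field, the inequality extends to the whole algebraic
  closure.\<close>

lemma ultrametric_value_embedding:
  fixes \<iota> :: "'k::field \<Rightarrow> 'c" and C :: "'c ring"
  assumes V: "V \<in> places" "\<not> archimedean_place V" "v \<in> V"
    and C: "is_C_v v C N \<iota>" and \<sigma>: "\<sigma> \<in> k_embeddings \<iota> C"
  shows "ultrametric_value (\<lambda>x. N (\<sigma> x))"
proof -
  interpret valued_field C N using C by (simp add: is_C_v_def)
  let ?R = "ring_of_type_algebra :: 'k alg_closure ring"
  have hom: "\<sigma> \<in> ring_hom ?R C" using \<sigma> by (simp add: k_embeddings_def)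
  have \<sigma>c: "\<sigma> x \<in> carrier C" for x
    using ring_hom_closed[OF hom, of x] by (simp add: ring_of_type_algebra_def)
  have \<sigma>m: "\<sigma> (x * y) = \<sigma> x \<otimes>\<^bsub>C\<^esub> \<sigma> y" for x y
    using ring_hom_mult[OF hom, of x y] by (simp add: ring_of_type_algebra_def)
  have \<sigma>a: "\<sigma> (x + y) = \<sigma> x \<oplus>\<^bsub>C\<^esub> \<sigma> y" for x y
    using ring_hom_add[OF hom, of x y] by (simp add: ring_of_type_algebra_def)
  have \<sigma>1: "\<sigma> 1 = \<one>\<^bsub>C\<^esub>"
    using ring_hom_one[OF hom] by (simp add: ring_of_type_algebra_def)
  have \<sigma>0: "\<sigma> 0 = \<zero>\<^bsub>C\<^esub>"
    using \<sigma>a[of 0 0] \<sigma>c[of 0] by (metis add.r_cancel_one' add_0)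
  have inj: "\<sigma> x = \<zero>\<^bsub>C\<^esub> \<longleftrightarrow> x = 0" for x
  proof
    assume "\<sigma> x = \<zero>\<^bsub>C\<^esub>"
    show "x = 0"
    proof (rule ccontr)
      assume "x \<noteq> 0"
      then have "\<sigma> 1 = \<sigma> x \<otimes>\<^bsub>C\<^esub> \<sigma> (inverse x)" by (simp flip: \<sigma>m)
      then show False using \<sigma>1 \<sigma>c \<open>\<sigma> x = \<zero>\<^bsub>C\<^esub>\<close> by simp
    qed
  qed (simp add: \<sigma>0)
  have ultra: "v (x + y) \<le> max (v x) (v y)" for x y
    using V by (metis archimedean_place_def not_le)
  have v: "N (\<sigma> (to_ac x)) = v x" for x
    using C \<sigma> by (auto simp: is_C_v_def k_embeddings_def)
  have v1: "v 1 = 1"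
  proof -
    have "v 1 = N \<one>\<^bsub>C\<^esub>" using v[of 1] \<sigma>1 by simp
    then show ?thesis using N_mult[of "\<one>\<^bsub>C\<^esub>" "\<one>\<^bsub>C\<^esub>"] N_eq_0_iff[of "\<one>\<^bsub>C\<^esub>"] by simp
  qed
  have v0: "v 0 = 0" using v[of 0] N_eq_0_iff[of "\<zero>\<^bsub>C\<^esub>"] \<sigma>0 by simp
  have "v (of_nat n) \<le> 1" for n
  proof (induction n)
    case (Suc n)
    then show ?case using ultra[of 1 "of_nat n"] v1 by simp
  qed (simp add: v0)
  then have "N (\<sigma> (of_nat n)) \<le> 1" for n
    using v[of "of_nat n"] by simp
  then show ?thesis
    by (intro ultrametric_valueI) (auto simp: N_nonneg N_eq_0_iff N_mult N_triangle \<sigma>c \<sigma>m \<sigma>a inj)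
qed

lemma periodic_parameter_S_integral:
  fixes c :: "'k::field alg_closure" and D :: "'k multiset"
  assumes arch: "\<And>V. V \<in> places \<Longrightarrow> archimedean_place V \<Longrightarrow> V \<in> S"
    and d: "d \<ge> 2" and p: "prime p" and c: "c \<noteq> 0" "(unicrit d c ^^ p) 0 = 0"
    and D: "\<And>a. a \<in># D \<Longrightarrow> postcritically_finite d (to_ac a) \<and>
              card {(unicrit d (to_ac a) ^^ n) 0 | n. True} < p"
  shows "S_integral S (image_mset to_ac D) c"
  unfolding S_integral_def
proof (intro ballI allI impI)
  fix V v b \<sigma> \<tau> and C :: "real ring" and N \<iota>
  assume V: "V \<in> places - S" "v \<in> V" and C: "is_C_v v C N \<iota>"
    and b: "b \<in># image_mset to_ac D"
    and \<sigma>: "\<sigma> \<in> k_embeddings \<iota> C" and \<tau>: "\<tau> \<in> k_embeddings \<iota> C"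
  obtain a where a: "a \<in># D" "b = to_ac a" using b by auto
  interpret valued_field C N using C by (simp add: is_C_v_def)
  interpret w: ultrametric_value "\<lambda>x. N (\<sigma> x)"
    using ultrametric_value_embedding[OF _ _ _ C \<sigma>, of V] V arch by auto
  \<comment> \<open>The point \<open>b\<close> comes from the base field, where both embeddings
    agree with \<open>\<iota>\<close>; one pullback along \<open>\<sigma>\<close> thus
    suffices.\<close>
  have \<tau>\<sigma>: "\<tau> b = \<sigma> b" using \<sigma> \<tau> a by (simp add: k_embeddings_def)
  have hom: "\<sigma> \<in> ring_hom ring_of_type_algebra C" using \<sigma> by (simp add: k_embeddings_def)
  have \<sigma>c: "\<sigma> x \<in> carrier C" for x
    using ring_hom_closed[OF hom, of x] by (simp add: ring_of_type_algebra_def)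
  have "\<sigma> c = \<sigma> (c - b) \<oplus>\<^bsub>C\<^esub> \<sigma> b"
    using ring_hom_add[OF hom, of "c - b" b] by (simp add: ring_of_type_algebra_def)
  then have "\<sigma> c \<ominus>\<^bsub>C\<^esub> \<sigma> b = \<sigma> (c - b)"
    using \<sigma>c by (simp add: a_minus_def a_assoc r_neg)
  moreover have "1 \<le> N (\<sigma> (c - b))" if "N (\<sigma> b) \<le> 1"
    using w.periodic_parameter_separated[OF d p c that] D a
    by (simp add: postcritically_finite_def)
  \<comment> \<open>This settles the clause of \<open>diff_residue_classes\<close> for
    \<open>N (\<sigma> b) > 1\<close>.\<close>
  moreover have "N (\<sigma> c) \<le> 1"
    using w.periodic_parameter_value[OF d prime_gt_0_nat[OF p] c(2)] .
  ultimately show "diff_residue_classes C N (\<sigma> c) (\<tau> b)"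
    by (simp add: diff_residue_classes_def \<tau>\<sigma>)
qed

theorem theorem5p1:
  fixes S :: "('k::field_char_0 \<Rightarrow> real) set set"
    and d r :: nat
    and \<alpha> :: "nat \<Rightarrow> 'k"
  assumes "number_field TYPE('k)"
    and "S \<subseteq> places" and "finite S"
    and "\<And>V. V \<in> places \<Longrightarrow> archimedean_place V \<Longrightarrow> V \<in> S"
    and "d \<ge> 2" and "r \<ge> 1"
    and "\<And>i. i \<in> {1..r} \<Longrightarrow> postcritically_finite d (to_ac (\<alpha> i))"
  shows "infinite {c :: 'k alg_closure.
           S_integral S (\<Sum>i=1..r. {#to_ac (\<alpha> i)#}) c \<and> postcritically_finite d c}"
    (is "infinite ?X")
proof -
  let ?card = "\<lambda>i. card {(unicrit d (to_ac (\<alpha> i)) ^^ n) 0 | n. True}"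
  define P where "P = {p. prime p \<and> (\<forall>i\<in>{1..r}. ?card i < p)}"
  \<comment> \<open>The sum serves as a common upper bound for all the orbit sizes, so
    \<open>P\<close> contains all but finitely many primes.\<close>
  have "{p. prime p} - {..(\<Sum>i=1..r. ?card i)} \<subseteq> P"
  proof
    fix p assume p: "p \<in> {p. prime p} - {..(\<Sum>i=1..r. ?card i)}"
    have "?card i \<le> (\<Sum>i=1..r. ?card i)" if "i \<in> {1..r}" for i
      using that by (intro member_le_sum) auto
    with p show "p \<in> P"
      by (auto simp: P_def not_le simp del: atLeastAtMost_iff intro: le_less_trans)
  qed
  moreover have "infinite ({p::nat. prime p} - {..(\<Sum>i=1..r. ?card i)})"
    using primes_infinite by (simp add: Diff_infinite_finite)
  ultimately have inf: "infinite P"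
    using finite_subset by blast
  have "\<forall>p\<in>P. \<exists>c::'k alg_closure. c \<noteq> 0 \<and> (unicrit d c ^^ p) 0 = 0"
  proof
    fix p assume "p \<in> P"
    then have "p \<ge> 2" by (simp add: P_def prime_ge_2_nat)
    with \<open>d \<ge> 2\<close> obtain c :: "'k alg_closure" where "c \<noteq> 0" "(unicrit d c ^^ p) 0 = 0"
      by (rule exists_periodic_parameter)
    then show "\<exists>c::'k alg_closure. c \<noteq> 0 \<and> (unicrit d c ^^ p) 0 = 0" by blast
  qed
  then obtain c :: "nat \<Rightarrow> 'k alg_closure"
    where c: "\<And>p. p \<in> P \<Longrightarrow> c p \<noteq> 0 \<and> (unicrit d (c p) ^^ p) 0 = 0"
    by metis
  have "inj_on c P"
  proof (rule inj_onI, rule ccontr)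
    fix p q assume pq: "p \<in> P" "q \<in> P" "c p = c q" "p \<noteq> q"
    then have "coprime p q" "p \<noteq> 0" by (auto simp: P_def primes_coprime prime_gt_0_nat)
    then show False
      using periodic_parameter_inj[OF \<open>d \<ge> 2\<close>, of p q "c p"] c pq by metis
  qed
  moreover have "c ` P \<subseteq> ?X"
  proof clarify
    fix p assume p: "p \<in> P"
    have D: "(\<Sum>i=1..r. {#to_ac (\<alpha> i)#}) = image_mset to_ac (image_mset \<alpha> (mset_set {1..r}))"
      by (simp add: sum_unfold_sum_mset image_mset.compositionality comp_def)
    show "S_integral S (\<Sum>i=1..r. {#to_ac (\<alpha> i)#}) (c p) \<and> postcritically_finite d (c p)"
      unfolding D
    proof
      have "prime p" using p by (simp add: P_def)
      then show "postcritically_finite d (c p)"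
        using c[OF p] prime_gt_0_nat[of p] periodic_imp_postcritically_finite by blast
      show "S_integral S (image_mset to_ac (image_mset \<alpha> (mset_set {1..r}))) (c p)"
      proof (rule periodic_parameter_S_integral[OF assms(4) \<open>d \<ge> 2\<close> \<open>prime p\<close>])
        fix a assume "a \<in># image_mset \<alpha> (mset_set {1..r})"
        then obtain i where "i \<in> {1..r}" "a = \<alpha> i" by auto
        with p show "postcritically_finite d (to_ac a) \<and>
            card {(unicrit d (to_ac a) ^^ n) 0 | n. True} < p"
          using assms(7) by (simp add: P_def)
      qed (use c[OF p] in auto)
    qed
  qed
  ultimately show ?thesis
    using inf by (meson finite_imageD finite_subset)
qed

end
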